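(* Let $n \geq 1$ be a natural number and let $P = (p(i,j))_{1 \leq i,j \leq n}$ be an $n \times n$ real matrix with the following properties: (1) $p(i,j) \geq 0$ for all $i,j \in \{1,\dots,n\}$; (2) for all $1 \leq i \leq n$, $\sum_{j=1}^n p(i,j) = 1$; (3) for all $i,j \in \{1,\dots,n\}$ there exists a natural number $k \geq 1$ such that the $(i,j)$ entry of the matrix power $P^k$ is strictly positive. Then there exists a unique row vector $v \in \mathbb{R}^n$ such that all entries of $v$ are strictly positive, the sum of the entries of $v$ is $1$, and $vP = v$.
   Context: Natural numbers are positive integers. $P^k$ denotes the $k$-th power of $P$ under matrix multiplication, and $vP$ denotes the product of the row vector $v$ with the matrix $P$, i.e. $(vP)(j) = \sum_{i=1}^n v(i)p(i,j)$. *)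

theory Defs
  imports "HOL-Analysis.Analysis"
begin

text \<open>
  Multiplication \<open>*\<close> on the type \<open>'a ^ 'n ^ 'n\<close>, and hence the overloaded power on it, is
  componentwise. Matrix powers are therefore defined by iterating \<open>**\<close>.
\<close>

primrec matpow :: "'a::semiring_1 ^ 'n ^ 'n \<Rightarrow> nat \<Rightarrow> 'a ^ 'n ^ 'n" where
  "matpow A 0 = mat 1"
| "matpow A (Suc k) = A ** matpow A k"

end

theory Submission
  imports Defs
begin

text \<open>
  If \<open>w\<close> is a left eigenvector of the stochastic matrix \<open>P\<close> for the eigenvalue 1, so is the vector
  \<open>\<bar>w\<bar>\<close> of absolute values: \<open>\<bar>w\<bar> \<le> \<bar>w\<bar> P\<close> entrywise by the triangle inequality, and both sides have
  the same sum of entries. Irreducibility makes every nonzero nonnegative fixed vector strictly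
  positive. For existence, \<open>P - 1\<close> kills the all-ones column, hence also some nonzero row vector
  \<open>w\<close>, and \<open>\<bar>w\<bar>\<close> can be normalised. For uniqueness, let \<open>d\<close> be a difference of two solutions. If \<open>d\<close>
  has a positive entry, then the fixed vector \<open>\<bar>d\<bar> + d\<close> is strictly positive, so \<open>d\<close> is strictly
  positive, although its entries sum to 0.
\<close>

lemma vector_matrix_mult_matpow_fixed:
  fixes P :: "'a::comm_semiring_1 ^ 'n ^ 'n"
  assumes "w v* P = w"
  shows "w v* matpow P k = w"
proof (induction k)
  case 0
  then show ?case by simp
next
  case (Suc k)
  have "w v* (P ** matpow P k) = (w v* P) v* matpow P k"
    by (simp add: vector_matrix_mul_assoc)
  then show ?case using Suc assms by simp
qed

lemma sum_vector_matrix_mult_stochastic: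
  fixes P :: "real ^ 'n ^ 'm"
  assumes row_sum: "\<And>i. (\<Sum>j\<in>UNIV. P $ i $ j) = 1"
  shows "(\<Sum>j\<in>UNIV. (w v* P) $ j) = (\<Sum>i\<in>UNIV. w $ i)"
proof -
  have "(\<Sum>j\<in>UNIV. (w v* P) $ j) = (\<Sum>i\<in>UNIV. \<Sum>j\<in>UNIV. P $ i $ j * w $ i)"
    unfolding vector_matrix_mult_def by (simp, subst sum.swap) (simp add: mult.commute)
  then show ?thesis
    by (simp add: row_sum flip: sum_distrib_right)
qed

lemma stochastic_fixed_abs:
  fixes P :: "real ^ 'n ^ 'n"
  assumes nonneg: "\<And>i j. P $ i $ j \<ge> 0"
    and row_sum: "\<And>i. (\<Sum>j\<in>UNIV. P $ i $ j) = 1"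
    and fixed: "w v* P = w"
  shows "(\<chi> i. \<bar>w $ i\<bar>) v* P = (\<chi> i. \<bar>w $ i\<bar>)"
proof -
  let ?a = "\<chi> i. \<bar>w $ i\<bar>"
  have le: "?a $ j \<le> (?a v* P) $ j" for j
  proof -
    have "\<bar>w $ j\<bar> = \<bar>\<Sum>i\<in>UNIV. P $ i $ j * w $ i\<bar>"
      using arg_cong[OF fixed, of "\<lambda>x. x $ j"]
      by (simp add: vector_matrix_mult_def mult.commute)
    also have "\<dots> \<le> (\<Sum>i\<in>UNIV. \<bar>P $ i $ j * w $ i\<bar>)" by (rule sum_abs)
    also have "\<dots> = (?a v* P) $ j"
      by (simp add: vector_matrix_mult_def abs_mult nonneg mult.commute)
    finally show ?thesis by simp
  qed
  \<comment> \<open>Row sums 1 make \<open>v* P\<close> preserve the total of the entries. The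
    differences, nonnegative by \<open>le\<close>, therefore sum to 0, so each of them
    vanishes.\<close>
  have "(\<Sum>j\<in>UNIV. (?a v* P) $ j - ?a $ j) = 0"
    by (simp add: sum_subtractf sum_vector_matrix_mult_stochastic[OF row_sum])
  then have "\<forall>j\<in>UNIV. (?a v* P) $ j - ?a $ j = 0"
    by (subst (asm) sum_nonneg_eq_0_iff) (use le in auto)
  then show ?thesis by (simp add: vec_eq_iff)
qed

text \<open>Since \<open>w\<close> is also fixed by \<open>matpow P k\<close>, its entry at
  \<open>j\<close> is a sum of nonnegative terms. For \<open>k\<close> chosen by irreducibility, the
  term coming from \<open>i\<close> is positive.\<close>

lemma irreducible_fixed_pos:
  fixes P :: "real ^ 'n ^ 'n"
  assumes nonneg: "\<And>i j. P $ i $ j \<ge> 0"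
    and irreducible: "\<And>i j. \<exists>k::nat. k \<ge> 1 \<and> matpow P k $ i $ j > 0"
    and fixed: "w v* P = w"
    and w_nonneg: "\<And>i. w $ i \<ge> 0"
    and "w $ i > 0"
  shows "w $ j > 0"
proof -
  have pow_nonneg: "matpow P k $ a $ b \<ge> 0" for k a b
    by (induction k arbitrary: a b)
      (auto simp: mat_def matrix_matrix_mult_def intro!: sum_nonneg mult_nonneg_nonneg nonneg)
  obtain k where k: "matpow P k $ i $ j > 0"
    using irreducible by blast
  have "0 < matpow P k $ i $ j * w $ i"
    using k assms by simp
  also have "\<dots> \<le> (\<Sum>l\<in>UNIV. matpow P k $ l $ j * w $ l)"
    by (rule member_le_sum) (auto simp: pow_nonneg w_nonneg)
  also have "\<dots> = (w v* matpow P k) $ j"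
    by (simp add: vector_matrix_mult_def mult.commute)
  finally show ?thesis
    by (simp add: vector_matrix_mult_matpow_fixed[OF fixed])
qed

lemma stochastic_fixed_exists:
  fixes P :: "real ^ 'n ^ 'n"
  assumes row_sum: "\<And>i. (\<Sum>j\<in>UNIV. P $ i $ j) = 1"
  obtains w where "w \<noteq> 0" "w v* P = w"
proof -
  have "(P - mat 1) *v 1 = 0"
    by (simp add: matrix_vector_mult_diff_rdistrib)
      (simp add: matrix_vector_mult_def vec_eq_iff row_sum)
  moreover have "(1 :: real ^ 'n) \<noteq> 0"
    by (simp add: vec_eq_iff)
  ultimately have "\<not> invertible (P - mat 1)"
    using invertible_left_inverse matrix_left_invertible_ker by blast
  \<comment> \<open>A square matrix is singular iff its transpose is; this trades the column kernel
    for a row kernel.\<close>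
  then have "\<not> invertible (transpose (P - mat 1))"
    by (metis transpose_invertible transpose_transpose)
  then obtain w where "w \<noteq> 0" "transpose (P - mat 1) *v w = 0"
    using invertible_left_inverse matrix_left_invertible_ker by blast
  then have "w \<noteq> 0" "w v* (P - mat 1) = 0"
    by simp_all
  then have "w v* P = w"
    by (simp add: vector_matrix_mult_diff_rdistrib)
  with \<open>w \<noteq> 0\<close> show ?thesis by (rule that)
qed

theorem theorem1:
  fixes P :: "real ^ 'n ^ 'n"
  assumes nonneg: "\<And>i j. P $ i $ j \<ge> 0"
    and row_sum: "\<And>i. (\<Sum>j\<in>UNIV. P $ i $ j) = 1"
    and irreducible: "\<And>i j. \<exists>k::nat. k \<ge> 1 \<and> matpow P k $ i $ j > 0"
  shows "\<exists>!v :: real ^ 'n. (\<forall>i. v $ i > 0) \<and> (\<Sum>i\<in>UNIV. v $ i) = 1 \<and> v v* P = v"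
proof (rule ex_ex1I)
  obtain w where "w \<noteq> 0" and w: "w v* P = w"
    using stochastic_fixed_exists[OF row_sum] .
  let ?a = "\<chi> i. \<bar>w $ i\<bar>"
  let ?s = "\<Sum>i\<in>UNIV. ?a $ i"
  note a_fixed = stochastic_fixed_abs[OF nonneg row_sum w]
  obtain i where "?a $ i > 0"
    using \<open>w \<noteq> 0\<close> by (auto simp: vec_eq_iff)
  then have a_pos: "?a $ j > 0" for j
    using irreducible_fixed_pos[OF nonneg irreducible a_fixed] by simp
  then have s_pos: "?s > 0"
    by (intro sum_pos) auto
  let ?v = "inverse ?s *\<^sub>R ?a"
  have "\<forall>i. ?v $ i > 0"
    using a_pos s_pos by simp
  moreover have "(\<Sum>i\<in>UNIV. ?v $ i) = 1"
    using s_pos by (simp flip: sum_distrib_left)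
  moreover have "?v v* P = ?v"
    by (simp only: scaleR_vector_matrix_assoc a_fixed)
  ultimately show "\<exists>v. (\<forall>i. v $ i > 0) \<and> (\<Sum>i\<in>UNIV. v $ i) = 1 \<and> v v* P = v"
    by blast
next
  fix u v :: "real ^ 'n"
  assume u: "(\<forall>i. u $ i > 0) \<and> (\<Sum>i\<in>UNIV. u $ i) = 1 \<and> u v* P = u"
    and v: "(\<forall>i. v $ i > 0) \<and> (\<Sum>i\<in>UNIV. v $ i) = 1 \<and> v v* P = v"
  define d where "d = u - v"
  have d_fixed: "d v* P = d"
    using u v by (simp add: d_def vector_matrix_mult_diff_distrib)
  have d_sum: "(\<Sum>i\<in>UNIV. d $ i) = 0"
    using u v by (simp add: d_def sum_subtractf)
  \<comment> \<open>Twice the positive part of \<open>d\<close>: nonnegative everywhere, and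
    positive exactly where \<open>d\<close> is.\<close>
  let ?e = "(\<chi> i. \<bar>d $ i\<bar>) + d"
  have e_fixed: "?e v* P = ?e"
    by (simp only: vector_matrix_left_distrib
        stochastic_fixed_abs[OF nonneg row_sum d_fixed] d_fixed)
  have e_nonneg: "?e $ i \<ge> 0" for i
    by simp
  have "d $ i \<le> 0" for i
  proof (rule ccontr)
    assume "\<not> d $ i \<le> 0"
    then have "?e $ i > 0" by simp
    then have e_pos: "?e $ j > 0" for j
      by (rule irreducible_fixed_pos[OF nonneg irreducible e_fixed e_nonneg])
    have "d $ j > 0" for j
      using e_pos[of j] by simp
    then have "(\<Sum>i\<in>UNIV. d $ i) > 0"
      by (intro sum_pos) auto
    with d_sum show False by simp
  qed
  \<comment> \<open>The one-sided bound suffices: the entries of \<open>- d\<close> are nonnegative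
    with sum 0.\<close>
  then have "\<forall>i\<in>UNIV. d $ i = 0"
    using d_sum sum_nonneg_eq_0_iff[of UNIV "\<lambda>i. - d $ i"] by (simp add: sum_negf)
  then show "u = v"
    by (simp add: d_def vec_eq_iff)
qed

end
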